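(* Let $0<q<p\le1$, let $k$ be a positive integer and $n\ge1$. Then $$C_{n,p,q}^{(k)}(x)=\sum_{m=0}^n(-1)^{n-m}S_1(n,m)\sum_{l=0}^m\binom ml \frac{(-x)^l}{[m-l+1]_{p,q}^k}=\sum_{m=0}^nS_1(n,m,x)\frac{(-1)^{n-m}}{[m+1]_{p,q}^k}.$$
   Context: $[n]_{p,q}=\frac{p^n-q^n}{p-q}$. For $0<q<p\le1$ (so $|p/q|>1$) the $(p,q)$-integral is $\int_0^x f(t)\,d_{p,q}t=(p-q)x\sum_{n=0}^\infty \frac{q^n}{p^{n+1}}f\!\left(\frac{q^n}{p^{n+1}}x\right)$. Let $(y)_n=y(y-1)\cdots(y-n+1)$, $(y)_0=1$. The $(p,q)$-poly-Cauchy polynomials of the first kind are $C_{n,p,q}^{(k)}(x)=\int_0^1\cdots\int_0^1 (t_1\cdots t_k-x)_n\,d_{p,q}t_1\cdots d_{p,q}t_k$ ($k$-fold). The unsigned Stirling numbers of the first kind $S_1(n,m)$ are defined by $x(x+1)\cdots(x+n-1)=\sum_{m=0}^n S_1(n,m)x^m$. The weighted Stirling numbers of the first kind are defined by $\frac{(1-t)^{-x}(-\ln(1-t))^m}{m!}=\sum_{n\ge m}S_1(n,m,x)\frac{t^n}{n!}$. *)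

theory Defs
  imports
    "HOL-Analysis.Analysis"
    "HOL-Combinatorics.Stirling"
    "HOL-Computational_Algebra.Formal_Power_Series"
begin

definition pq_number :: "real \<Rightarrow> real \<Rightarrow> nat \<Rightarrow> real" where
  "pq_number p q n = (p ^ n - q ^ n) / (p - q)"

definition pq_integral ::
  "real \<Rightarrow> real \<Rightarrow> (real \<Rightarrow> 'a::real_normed_vector) \<Rightarrow> real \<Rightarrow> 'a" where
  "pq_integral p q f x =
     ((p - q) * x) *\<^sub>R
       (\<Sum>n. (q ^ n / p ^ (n + 1)) *\<^sub>R f (q ^ n / p ^ (n + 1) * x))"

text \<open>
  The iterated integral over [0,1] in each variable, where the integrand takes the list
  of variables t_1, ..., t_k. The head t_1 is integrated first (innermost), t_k last.
\<close>

primrec pq_multi_integral ::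
  "real \<Rightarrow> real \<Rightarrow> nat \<Rightarrow> (real list \<Rightarrow> 'a::real_normed_vector) \<Rightarrow> 'a" where
  "pq_multi_integral p q 0 F = F []"
| "pq_multi_integral p q (Suc k) F =
     pq_multi_integral p q k (\<lambda>ts. pq_integral p q (\<lambda>t. F (t # ts)) 1)"

definition falling_factorial :: "'a::comm_ring_1 \<Rightarrow> nat \<Rightarrow> 'a" where
  "falling_factorial y n = (\<Prod>i<n. y - of_nat i)"

definition pq_poly_cauchy ::
  "nat \<Rightarrow> real \<Rightarrow> real \<Rightarrow> nat \<Rightarrow> 'a::real_normed_field \<Rightarrow> 'a" where
  "pq_poly_cauchy n p q k x =
     pq_multi_integral p q k (\<lambda>ts. falling_factorial (of_real (prod_list ts) - x) n)"

text \<open>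
  The coefficient of t^n/n! in (1-t)^(-x) (-ln(1-t))^m / m!, as a formal power series in t.
  In the library, \<^term>\<open>fps_binomial a\<close> is (1+t)^a and \<^term>\<open>fps_ln 1\<close> is ln(1+t).
\<close>

definition weighted_stirling :: "nat \<Rightarrow> nat \<Rightarrow> 'a::field_char_0 \<Rightarrow> 'a" where
  "weighted_stirling n m x =
     fact n * fps_nth
       (fps_const (1 / fact m) *
        ((fps_binomial (- x) oo (- fps_X)) * (- (fps_ln 1 oo (- fps_X))) ^ m)) n"

end

theory Submission imports Defs begin

text \<open>
  Since the \<open>(p,q)\<close>-integral of \<open>t ^ j\<close> over \<open>[0,1]\<close> is \<open>1 / [j + 1]\<close>, the \<open>k\<close>-fold integral of a
  polynomial in \<open>t\<^sub>1 \<cdots> t\<^sub>k\<close> is obtained by replacing \<open>y ^ j\<close> with \<open>1 / [j + 1] ^ k\<close>. The two sums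
  arise from two expansions of \<open>(y - x)\<^sub>n\<close> in powers of \<open>y\<close>: by Stirling numbers and the binomial
  theorem, and by weighted Stirling numbers, whose triangular recurrence comes from differentiating
  the generating function.
\<close>

text \<open>At the endpoint 1 the weight and the node of each term coincide, so a term is a
  \<open>Suc j\<close>-th power and the series is geometric with ratio
  \<open>(q / p) ^ Suc j\<close> < 1. The prefactor \<open>p - q\<close> of the integral is left out
  here, hence the \<open>p - q\<close> in the limit.\<close>

lemma pq_integral_power_sums:
  fixes p q :: real
  assumes "0 < q" "q < p"
  shows "(\<lambda>n. q ^ n / p ^ (n + 1) * (q ^ n / p ^ (n + 1)) ^ j)
           sums (1 / ((p - q) * pq_number p q (Suc j)))"
proof -
  have p: "p > 0" using assms by simp
  define r where "r = (q / p) ^ Suc j"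
  have r: "\<bar>r\<bar> < 1"
    using assms p power_strict_mono[of "q / p" 1 "Suc j"] unfolding r_def
    by (simp del: power_Suc)
  have "(\<lambda>n. 1 / p ^ Suc j * r ^ n) sums (1 / p ^ Suc j * (1 / (1 - r)))"
    by (intro sums_mult geometric_sums) (use r in simp)
  moreover have "1 / p ^ Suc j * r ^ n = q ^ n / p ^ (n + 1) * (q ^ n / p ^ (n + 1)) ^ j" for n
  proof -
    have "q ^ n / p ^ (n + 1) * (q ^ n / p ^ (n + 1)) ^ j = (q ^ n / p ^ (n + 1)) ^ Suc j"
      by simp
    also have "\<dots> = ((q / p) ^ n * (1 / p)) ^ Suc j"
      by (simp add: power_divide mult.commute)
    also have "\<dots> = 1 / p ^ Suc j * r ^ n"
      unfolding r_def power_mult_distrib power_mult[symmetric]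
      by (simp add: mult.commute power_divide del: power_Suc)
    finally show ?thesis ..
  qed
  moreover have "1 / p ^ Suc j * (1 / (1 - r)) = 1 / ((p - q) * pq_number p q (Suc j))"
  proof -
    have "p ^ Suc j * (1 - r) = p ^ Suc j - q ^ Suc j"
      using p unfolding r_def power_divide by (simp add: right_diff_distrib del: power_Suc)
    then show ?thesis
      using assms unfolding pq_number_def by (simp del: power_Suc)
  qed
  ultimately show ?thesis by simp
qed

text \<open>The parameter \<open>s\<close> stands for the product of the variables still to be
  integrated: integrating one variable only rescales the coefficients and keeps the shape of the
  sum, so the step can be iterated. The index set and exponent map are free, so that double sums
  with repeated exponents are covered.\<close>

lemma pq_integral_polynomial:
  fixes p q :: real and a :: "'i \<Rightarrow> 'a::real_normed_field"
  assumes "0 < q" "q < p"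
  shows "pq_integral p q (\<lambda>t. \<Sum>i\<in>I. a i * of_real (t * s) ^ e i) 1 =
           (\<Sum>i\<in>I. a i / of_real (pq_number p q (Suc (e i))) * of_real s ^ e i)"
proof -
  define w where "w n = q ^ n / p ^ (n + 1)" for n
  let ?c = "\<lambda>j. 1 / ((p - q) * pq_number p q (Suc j))"
  have "(\<lambda>n. (w n * w n ^ j)) sums ?c j" for j
    using pq_integral_power_sums[OF assms] unfolding w_def .
  then have "(\<lambda>n. \<Sum>i\<in>I. of_real (w n * w n ^ e i) * (a i * of_real s ^ e i))
      sums (\<Sum>i\<in>I. of_real (?c (e i)) * (a i * of_real s ^ e i))"
    by (intro sums_sum sums_mult2 sums_of_real)
  moreover have "(\<Sum>i\<in>I. of_real (w n * w n ^ e i) * (a i * of_real s ^ e i)) =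
      w n *\<^sub>R (\<Sum>i\<in>I. a i * of_real (w n * s) ^ e i)" for n
    by (simp add: scaleR_conv_of_real sum_distrib_left power_mult_distrib mult_ac)
  ultimately have "(\<Sum>n. w n *\<^sub>R (\<Sum>i\<in>I. a i * of_real (w n * s) ^ e i)) =
      (\<Sum>i\<in>I. of_real (?c (e i)) * (a i * of_real s ^ e i))"
    by (simp add: sums_iff)
  then have "pq_integral p q (\<lambda>t. \<Sum>i\<in>I. a i * of_real (t * s) ^ e i) 1 =
      of_real (p - q) * (\<Sum>i\<in>I. of_real (?c (e i)) * (a i * of_real s ^ e i))"
    unfolding pq_integral_def w_def by (simp add: scaleR_conv_of_real)
  also have "\<dots> = (\<Sum>i\<in>I. of_real ((p - q) * ?c (e i)) * (a i * of_real s ^ e i))"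
    by (simp only: sum_distrib_left of_real_mult mult.assoc)
  \<comment> \<open>The prefactor \<open>p - q\<close> cancels against the one in
    \<open>?c\<close>.\<close>
  also have "\<dots> = (\<Sum>i\<in>I. a i / of_real (pq_number p q (Suc (e i))) * of_real s ^ e i)"
    using assms by (intro sum.cong) (simp_all add: of_real_divide)
  finally show ?thesis .
qed

lemma pq_multi_integral_polynomial:
  fixes p q :: real and a :: "'i \<Rightarrow> 'a::real_normed_field"
  assumes "0 < q" "q < p"
  shows "pq_multi_integral p q k (\<lambda>ts. \<Sum>i\<in>I. a i * of_real (prod_list ts) ^ e i) =
           (\<Sum>i\<in>I. a i / of_real (pq_number p q (Suc (e i))) ^ k)"
proof (induction k arbitrary: a)
  case 0
  show ?case by simp
next
  case (Suc k)
  show ?case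
    \<comment> \<open>Integrating the head variable has divided each coefficient once; the remaining
      variables are handled by the induction hypothesis for these new coefficients.\<close>
    using Suc[of "\<lambda>i. a i / of_real (pq_number p q (Suc (e i)))"]
    by (simp add: pq_integral_polynomial[OF assms] del: of_real_mult)
qed

lemma minus_one_power_mult_minus_power:
  fixes y :: "'a::comm_ring_1"
  assumes "m \<le> n"
  shows "(- 1) ^ n * (- y) ^ m = (- 1) ^ (n - m) * y ^ m"
proof -
  have "(- 1) ^ n * (- y) ^ m = (- 1) ^ (n - m) * ((- 1) ^ m * (- y) ^ m)"
    using assms by (simp add: power_add[symmetric] mult.assoc[symmetric])
  also have "(- 1) ^ m * (- y) ^ m = y ^ m"
    by (simp add: power_mult_distrib[symmetric])
  finally show ?thesis .
qed

lemma falling_factorial_Suc: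
  "falling_factorial y (Suc n) = falling_factorial y n * (y - of_nat n)"
  by (simp add: falling_factorial_def)

lemma falling_factorial_conv_stirling:
  fixes y :: "'a::comm_ring_1"
  shows "falling_factorial y n = (\<Sum>m=0..n. (- 1) ^ (n - m) * of_nat (stirling n m) * y ^ m)"
proof -
  \<comment> \<open>Reflecting y to -y turns the falling factorial into a rising one, whose
    coefficients are the unsigned Stirling numbers.\<close>
  have "falling_factorial y n = (- 1) ^ n * pochhammer (- y) n"
    unfolding falling_factorial_def pochhammer_prod
    by (induction n) (simp_all add: algebra_simps)
  also have "\<dots> = (\<Sum>m=0..n. (- 1) ^ n * (of_nat (stirling n m) * (- y) ^ m))"
    by (simp add: stirling_pochhammer[symmetric] sum_distrib_left atLeast0AtMost)
  also have "\<dots> = (\<Sum>m=0..n. (- 1) ^ (n - m) * of_nat (stirling n m) * y ^ m)"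
    by (intro sum.cong refl) (simp add: minus_one_power_mult_minus_power mult.left_commute mult.assoc)
  finally show ?thesis .
qed

text \<open>This is the differential equation of (1-t)^(-x), obtained by substituting -t into that
  of (1+t)^(-x); the chain rule contributes the sign that turns -x into x.\<close>

lemma one_minus_X_deriv_binomial:
  fixes x :: "'a::field_char_0"
  defines "B \<equiv> fps_binomial (- x) oo (- fps_X)"
  shows "(1 - fps_X) * fps_deriv B = fps_const x * B"
proof -
  have "(1 + fps_X) * fps_deriv (fps_binomial (- x)) = fps_const (- x) * fps_binomial (- x)"
    by (simp add: fps_binomial_deriv fps_divide_unit inverse_mult_eq_1')
  then have "((1 + fps_X) * fps_deriv (fps_binomial (- x))) oo (- fps_X) =
      (fps_const (- x) * fps_binomial (- x)) oo (- fps_X)" by simp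
  then have "(1 - fps_X) * (fps_deriv (fps_binomial (- x)) oo (- fps_X)) = - (fps_const x * B)"
    by (simp add: fps_compose_mult_distrib fps_compose_add_distrib B_def fps_compose_uminus flip: fps_const_neg)
  then show ?thesis
    by (simp add: B_def fps_compose_deriv)
qed

lemma one_minus_X_deriv_ln:
  fixes L :: "'a::field_char_0 fps"
  defines "L \<equiv> - (fps_ln 1 oo (- fps_X))"
  shows "(1 - fps_X) * fps_deriv L = 1"
proof -
  have "(1 + fps_X) * fps_deriv (fps_ln (1::'a)) = 1"
    by (simp add: fps_ln_deriv fps_divide_unit inverse_mult_eq_1')
  then have "((1 + fps_X) * fps_deriv (fps_ln (1::'a))) oo (- fps_X) = 1 oo (- fps_X)" by simp
  then have "(1 - fps_X) * (fps_deriv (fps_ln (1::'a)) oo (- fps_X)) = 1"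
    by (simp add: fps_compose_mult_distrib fps_compose_add_distrib)
  then show ?thesis
    by (simp add: L_def fps_compose_deriv)
qed

lemma weighted_stirling_0:
  "weighted_stirling 0 m x = (if m = 0 then 1 else 0)"
  by (simp add: weighted_stirling_def fps_ln_def)

text \<open>With F_m the generating function, the product rule and the equations for B and L give
  (1-t) F_m' = x F_m + F_(m-1); comparing coefficients of t^n yields the recurrence.\<close>

lemma weighted_stirling_Suc:
  fixes x :: "'a::field_char_0"
  shows "weighted_stirling (Suc n) m x = (x + of_nat n) * weighted_stirling n m x +
           (if m = 0 then 0 else weighted_stirling n (m - 1) x)"
proof -
  define B where "B = fps_binomial (- x) oo (- fps_X)"
  define L :: "'a fps" where "L = - (fps_ln 1 oo (- fps_X))"
  define F where "F m = fps_const (1 / fact m) * (B * L ^ m)" for m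
  have W: "weighted_stirling n m x = fact n * fps_nth (F m) n" for n m
    by (simp only: weighted_stirling_def F_def B_def L_def)
  have B: "(1 - fps_X) * fps_deriv B = fps_const x * B"
    unfolding B_def by (rule one_minus_X_deriv_binomial)
  have L: "(1 - fps_X) * fps_deriv L = 1"
    unfolding L_def by (rule one_minus_X_deriv_ln)
  have "(1 - fps_X) * fps_deriv (F m) =
      fps_const x * F m + (if m = 0 then 0 else F (m - 1))"
  proof (cases m)
    case 0
    then show ?thesis using B by (simp add: F_def)
  next
    case (Suc j)
    have "fps_deriv (L ^ m) = fps_const (of_nat m) * L ^ j * fps_deriv L"
      unfolding fps_deriv_power Suc by (simp add: mult_ac del: of_nat_Suc power_Suc)
    then have "fps_deriv (F m) = fps_const (1 / fact m) *
        (fps_deriv B * L ^ m + B * (fps_const (of_nat m) * L ^ j * fps_deriv L))"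
      by (simp add: F_def add.commute)
    then have "(1 - fps_X) * fps_deriv (F m) = fps_const (1 / fact m) *
       (((1 - fps_X) * fps_deriv B) * L ^ m +
         B * (fps_const (of_nat m) * L ^ j * ((1 - fps_X) * fps_deriv L)))"
      by (simp only: distrib_left distrib_right mult_ac)
    also have "\<dots> = fps_const x * F m +
        (fps_const (1 / fact m) * fps_const (of_nat m)) * (B * L ^ j)"
      unfolding B L by (simp add: F_def algebra_simps)
    \<comment> \<open>Since m / m! = 1 / (m-1)!, the second summand is exactly F_(m-1).\<close>
    also have "fps_const (1 / fact m) * fps_const (of_nat m) = fps_const (1 / fact j :: 'a)"
      by (simp add: Suc field_simps del: of_nat_Suc)
    finally show ?thesis by (simp add: F_def Suc)
  qed
  then have "fps_nth ((1 - fps_X) * fps_deriv (F m)) n =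
      fps_nth (fps_const x * F m + (if m = 0 then 0 else F (m - 1))) n" by simp
  \<comment> \<open>The part -t F_m' contributes -n times the n-th coefficient of F_m; moved to the
    right, it changes x into x + n.\<close>
  then have "of_nat (Suc n) * fps_nth (F m) (Suc n) =
      (x + of_nat n) * fps_nth (F m) n + (if m = 0 then 0 else fps_nth (F (m - 1)) n)"
    by (cases n) (auto simp: left_diff_distrib algebra_simps)
  then have "fact n * (of_nat (Suc n) * fps_nth (F m) (Suc n)) =
      fact n * ((x + of_nat n) * fps_nth (F m) n + (if m = 0 then 0 else fps_nth (F (m - 1)) n))" by simp
  then show ?thesis
    unfolding W by (simp add: algebra_simps split: if_splits)
qed

lemma weighted_stirling_eq_0: "n < m \<Longrightarrow> weighted_stirling n m x = 0"
  by (induction n arbitrary: m) (auto simp: weighted_stirling_0 weighted_stirling_Suc)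

lemma falling_factorial_conv_weighted_stirling:
  fixes x y :: "'a::field_char_0"
  shows "falling_factorial (y - x) n =
           (\<Sum>m=0..n. weighted_stirling n m x * (- 1) ^ (n - m) * y ^ m)"
proof -
  \<comment> \<open>In powers of -y the induction needs no alternating signs: the new factor y - x -
    n is -(x + n - y), and its sign is absorbed by \<open>(- 1) ^ n\<close>.\<close>
  have "falling_factorial (y - x) n = (- 1) ^ n * (\<Sum>m\<le>n. weighted_stirling n m x * (- y) ^ m)"
  proof (induction n)
    case 0
    show ?case by (simp add: falling_factorial_def weighted_stirling_0)
  next
    case (Suc n)
    let ?S = "\<Sum>m\<le>n. weighted_stirling n m x * (- y) ^ m"
    have "(\<Sum>m\<le>Suc n. weighted_stirling (Suc n) m x * (- y) ^ m) =
        (x + of_nat n) * (\<Sum>m\<le>Suc n. weighted_stirling n m x * (- y) ^ m) +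
        (\<Sum>m\<le>Suc n. (if m = 0 then 0 else weighted_stirling n (m - 1) x) * (- y) ^ m)"
      by (simp add: weighted_stirling_Suc sum_distrib_left sum.distrib algebra_simps
               del: sum.atMost_Suc)
    \<comment> \<open>The top term vanishes because there m = n + 1 exceeds n.\<close>
    also have "(\<Sum>m\<le>Suc n. weighted_stirling n m x * (- y) ^ m) = ?S"
      by (simp add: weighted_stirling_eq_0)
    \<comment> \<open>The term m = 0 is zero, and shifting the index releases one factor -y.\<close>
    also have "(\<Sum>m\<le>Suc n. (if m = 0 then 0 else weighted_stirling n (m - 1) x) * (- y) ^ m) =
        - y * ?S"
      by (subst sum.atMost_Suc_shift) (simp add: sum_distrib_left sum_negf mult_ac)
    finally have S: "(\<Sum>m\<le>Suc n. weighted_stirling (Suc n) m x * (- y) ^ m) =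
        (x + of_nat n - y) * ?S" by (simp add: algebra_simps del: sum.atMost_Suc)
    show ?case
      unfolding falling_factorial_Suc Suc S by (simp add: algebra_simps)
  qed
  also have "\<dots> = (\<Sum>m=0..n. weighted_stirling n m x * (- 1) ^ (n - m) * y ^ m)"
    unfolding sum_distrib_left atLeast0AtMost
    by (intro sum.cong refl) (simp add: minus_one_power_mult_minus_power mult.left_commute mult.assoc)
  finally show ?thesis .
qed

theorem theorem10:
  fixes p q :: real and k n :: nat and x :: "'a::real_normed_field"
  assumes "0 < q" and "q < p" and "p \<le> 1" and "k \<ge> 1" and "n \<ge> 1"
  shows "pq_poly_cauchy n p q k x =
           (\<Sum>m=0..n. (- 1) ^ (n - m) * of_nat (stirling n m) *
              (\<Sum>l=0..m. of_nat (m choose l) * ((- x) ^ l / of_real (pq_number p q (m - l + 1)) ^ k)))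
       \<and> (\<Sum>m=0..n. (- 1) ^ (n - m) * of_nat (stirling n m) *
              (\<Sum>l=0..m. of_nat (m choose l) * ((- x) ^ l / of_real (pq_number p q (m - l + 1)) ^ k))) =
           (\<Sum>m=0..n. weighted_stirling n m x * ((- 1) ^ (n - m) / of_real (pq_number p q (m + 1)) ^ k))"
proof -
  let ?c = "\<lambda>m l. (- 1) ^ (n - m) * of_nat (stirling n m) * (of_nat (m choose l) * (- x) ^ l)"
  \<comment> \<open>Expanding each (y - x)^m binomially and flattening the double sum over pairs (m,
    l) gives a single sum of monomials with exponent m - l, the form that
    \<open>pq_multi_integral_polynomial\<close> integrates.\<close>
  have "falling_factorial (y - x) n =
      (\<Sum>(m, l)\<in>(SIGMA m:{0..n}. {0..m}). ?c m l * y ^ (m - l))" for y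
  proof -
    have "(y - x) ^ m = (\<Sum>l=0..m. of_nat (m choose l) * (- x) ^ l * y ^ (m - l))" for m
      using binomial_ring[of "- x" y m] by (simp add: atLeast0AtMost)
    then show ?thesis
      by (simp add: falling_factorial_conv_stirling sum.Sigma[symmetric] sum_distrib_left mult_ac)
  qed
  then have 1: "pq_poly_cauchy n p q k x = 
      (\<Sum>(m, l)\<in>(SIGMA m:{0..n}. {0..m}). ?c m l / of_real (pq_number p q (Suc (m - l))) ^ k)"
    using pq_multi_integral_polynomial[OF assms(1,2), where
        I = "SIGMA m:{0..n}. {0..m}" and a = "\<lambda>(m, l). ?c m l" and e = "\<lambda>(m, l). m - l"]
    by (simp add: pq_poly_cauchy_def case_prod_unfold)
  \<comment> \<open>The weighted expansion is already in powers of y, so the same integration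
    applies with exponent m; equating both evaluations gives the second identity.\<close>
  have 2: "pq_poly_cauchy n p q k x =
      (\<Sum>m=0..n. weighted_stirling n m x * (- 1) ^ (n - m) / of_real (pq_number p q (Suc m)) ^ k)"
    unfolding pq_poly_cauchy_def falling_factorial_conv_weighted_stirling
    by (rule pq_multi_integral_polynomial[OF assms(1,2)])
  from 1 2 show ?thesis
    by (simp add: sum.Sigma[symmetric] sum_distrib_left mult.assoc)
qed

end
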